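(* Let $G$ be a finite group and let $k$ be a commutative Noetherian ring with identity. Then the category $FI_G$ is locally Noetherian over $k$; that is, every submodule of a finitely generated $FI_G$-module over $k$ is again finitely generated.
   Context: For a group $G$, $FI_G$ is the category whose objects are finite sets and whose morphisms $S\to T$ are pairs $(f,g)$ with $f:S\to T$ an injection and $g:S\to G$ an arbitrary function; composition is $(f_1,g_1)\circ(f_2,g_2)=(f_1\circ f_2,h)$ with $h(x)=g_1(f_2(x))\,g_2(x)$. (For $G$ trivial this is the category $FI$ of finite sets and injections.) An $FI_G$-module over $k$ is a covariant functor $V$ from $FI_G$ to the category of $k$-modules; submodules are subfunctors. $V$ is finitely generated if there are finitely many elements $v_i\in V(S_i)$ (with $S_i$ finite sets) such that no proper submodule of $V$ contains all the $v_i$. *)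

theory Defs
  imports
    "HOL-Algebra.Ring_Divisibility"
    "HOL-Algebra.Module"
    "HOL-Library.FuncSet"
    "HOL-Library.Infinite_Typeclass"
begin

section \<open>The category \<open>FI\<^sub>G\<close>\<close>

text \<open>
  The objects are the finite sets \<open>S :: 'x set\<close>. The point type \<open>'x\<close> plays the role of a universe
  of points: as soon as it is infinite, every finite set is in bijection with an object, so that
  this is (up to equivalence) the category of all finite sets with \<open>FI\<^sub>G\<close>-morphisms.

  Both components of a morphism \<open>S \<rightarrow> T\<close> are functions on \<open>S\<close> only; they are represented by functions
  that are undefined outside \<open>S\<close>, so that equality of pairs is equality of morphisms. Source and
  target cannot be recovered from the pair and are passed separately where they matter.
\<close>

type_synonym ('x, 'g) fig_mor = "('x \<Rightarrow> 'x) \<times> ('x \<Rightarrow> 'g)"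

definition fig_hom ::
    "('g, 'c) monoid_scheme \<Rightarrow> 'x set \<Rightarrow> 'x set \<Rightarrow> ('x, 'g) fig_mor set" where
  "fig_hom G S T = {(f, g). f \<in> S \<rightarrow>\<^sub>E T \<and> inj_on f S \<and> g \<in> S \<rightarrow>\<^sub>E carrier G}"

definition fig_id :: "('g, 'c) monoid_scheme \<Rightarrow> 'x set \<Rightarrow> ('x, 'g) fig_mor" where
  "fig_id G S = (\<lambda>x\<in>S. x, \<lambda>x\<in>S. \<one>\<^bsub>G\<^esub>)"

text \<open>\<open>fig_comp G S \<phi> \<psi>\<close> is the composite of \<open>\<psi> : S \<rightarrow> T\<close> followed by \<open>\<phi> : T \<rightarrow> U\<close>.\<close>

definition fig_comp ::
    "('g, 'c) monoid_scheme \<Rightarrow> 'x set \<Rightarrow> ('x, 'g) fig_mor \<Rightarrow> ('x, 'g) fig_mor \<Rightarrow> ('x, 'g) fig_mor" where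
  "fig_comp G S \<phi> \<psi> =
     (\<lambda>x\<in>S. fst \<phi> (fst \<psi> x), \<lambda>x\<in>S. snd \<phi> (fst \<psi> x) \<otimes>\<^bsub>G\<^esub> snd \<psi> x)"

lemma (in group) fig_id_in_hom: "fig_id G S \<in> fig_hom G S S"
  by (auto simp: fig_id_def fig_hom_def inj_on_def)

lemma (in group) fig_comp_in_hom:
  assumes "\<psi> \<in> fig_hom G S T" "\<phi> \<in> fig_hom G T U"
  shows "fig_comp G S \<phi> \<psi> \<in> fig_hom G S U"
  using assms by (auto simp: fig_comp_def fig_hom_def inj_on_def PiE_iff)

lemma (in group) fig_comp_id_right:
  assumes "\<phi> \<in> fig_hom G S T"
  shows "fig_comp G S \<phi> (fig_id G S) = \<phi>"
  using assms by (auto simp: fig_comp_def fig_hom_def fig_id_def PiE_iff extensional_def fun_eq_iff)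

lemma (in group) fig_comp_id_left:
  assumes "\<phi> \<in> fig_hom G S T"
  shows "fig_comp G S (fig_id G T) \<phi> = \<phi>"
  using assms by (auto simp: fig_comp_def fig_hom_def fig_id_def PiE_iff extensional_def intro!: ext)

lemma (in group) fig_comp_assoc:
  assumes "\<chi> \<in> fig_hom G S T" "\<psi> \<in> fig_hom G T U" "\<phi> \<in> fig_hom G U X"
  shows "fig_comp G S \<phi> (fig_comp G S \<psi> \<chi>) = fig_comp G S (fig_comp G T \<phi> \<psi>) \<chi>"
  using assms by (auto simp: fig_comp_def fig_hom_def PiE_iff fun_eq_iff m_assoc)


section \<open>\<open>FI\<^sub>G\<close>-modules\<close>

definition linear_maps ::
    "('k, 'd) ring_scheme \<Rightarrow> ('k, 'v, 'm) module_scheme \<Rightarrow> ('k, 'w, 'n) module_scheme \<Rightarrow> ('v \<Rightarrow> 'w) set" where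
  "linear_maps k M N =
     {h. h \<in> carrier M \<rightarrow> carrier N
       \<and> (\<forall>x\<in>carrier M. \<forall>y\<in>carrier M. h (x \<oplus>\<^bsub>M\<^esub> y) = h x \<oplus>\<^bsub>N\<^esub> h y)
       \<and> (\<forall>a\<in>carrier k. \<forall>x\<in>carrier M. h (a \<odot>\<^bsub>M\<^esub> x) = a \<odot>\<^bsub>N\<^esub> h x)}"

text \<open>
  A functor from \<open>FI\<^sub>G\<close> to \<open>k\<close>-modules is given by its object part \<open>V\<close> and its morphism part
  \<open>A S T \<phi> : V S \<rightarrow> V T\<close> for \<open>\<phi> : S \<rightarrow> T\<close>. Only the values on finite sets matter. The modules \<open>V S\<close> may have
  different carriers inside the type \<open>'v\<close>.
\<close>

locale fig_module = G: group G + k: cring k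
  for G :: "('g, 'c) monoid_scheme"
    and k :: "('k, 'd) ring_scheme"
    and V :: "'x set \<Rightarrow> ('k, 'v) module"
    and A :: "'x set \<Rightarrow> 'x set \<Rightarrow> ('x, 'g) fig_mor \<Rightarrow> 'v \<Rightarrow> 'v" +
  assumes obj: "finite S \<Longrightarrow> module k (V S)"
    and mor: "\<lbrakk>finite S; finite T; \<phi> \<in> fig_hom G S T\<rbrakk> \<Longrightarrow> A S T \<phi> \<in> linear_maps k (V S) (V T)"
    and map_id: "\<lbrakk>finite S; v \<in> carrier (V S)\<rbrakk> \<Longrightarrow> A S S (fig_id G S) v = v"
    and map_comp: "\<lbrakk>finite S; finite T; finite U; \<psi> \<in> fig_hom G S T; \<phi> \<in> fig_hom G T U;
        v \<in> carrier (V S)\<rbrakk> \<Longrightarrow> A S U (fig_comp G S \<phi> \<psi>) v = A T U \<phi> (A S T \<psi> v)"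

definition fig_submodule ::
    "('g, 'c) monoid_scheme \<Rightarrow> ('k, 'd) ring_scheme \<Rightarrow> ('x set \<Rightarrow> ('k, 'v) module) \<Rightarrow>
     ('x set \<Rightarrow> 'x set \<Rightarrow> ('x, 'g) fig_mor \<Rightarrow> 'v \<Rightarrow> 'v) \<Rightarrow> ('x set \<Rightarrow> 'v set) \<Rightarrow> bool" where
  "fig_submodule G k V A W \<longleftrightarrow>
     (\<forall>S. finite S \<longrightarrow> submodule (W S) k (V S)) \<and>
     (\<forall>S T. finite S \<longrightarrow> finite T \<longrightarrow> (\<forall>\<phi>\<in>fig_hom G S T. A S T \<phi> ` W S \<subseteq> W T))"

definition fig_restrict ::
    "('x set \<Rightarrow> ('k, 'v) module) \<Rightarrow> ('x set \<Rightarrow> 'v set) \<Rightarrow> ('x set \<Rightarrow> ('k, 'v) module)" where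
  "fig_restrict V W = (\<lambda>S. V S\<lparr>carrier := W S\<rparr>)"

definition fig_finitely_generated ::
    "('g, 'c) monoid_scheme \<Rightarrow> ('k, 'd) ring_scheme \<Rightarrow> ('x set \<Rightarrow> ('k, 'v) module) \<Rightarrow>
     ('x set \<Rightarrow> 'x set \<Rightarrow> ('x, 'g) fig_mor \<Rightarrow> 'v \<Rightarrow> 'v) \<Rightarrow> bool" where
  "fig_finitely_generated G k V A \<longleftrightarrow>
     (\<exists>E. finite E \<and> (\<forall>(S, v)\<in>E. finite S \<and> v \<in> carrier (V S)) \<and>
        \<not> (\<exists>W. fig_submodule G k V A W \<and> (\<forall>(S, v)\<in>E. v \<in> W S) \<and>
              (\<exists>S. finite S \<and> W S \<noteq> carrier (V S))))"

text \<open>A submodule is itself an \<open>FI\<^sub>G\<close>-module, with the structure maps of the ambient module.\<close>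

lemma (in fig_module) fig_module_restrict:
  assumes W: "fig_submodule G k V A W"
  shows "fig_module G k (fig_restrict V W) A"
proof -
  have sub: "submodule (W S) k (V S)" if "finite S" for S
    using W that by (auto simp: fig_submodule_def)
  have stable: "A S T \<phi> v \<in> W T"
    if "finite S" "finite T" "\<phi> \<in> fig_hom G S T" "v \<in> W S" for S T \<phi> v
    using W that by (fastforce simp: fig_submodule_def)
  have car: "v \<in> carrier (V S)" if "finite S" "v \<in> W S" for S v
    using module.submoduleE(1)[OF obj[OF that(1)] sub[OF that(1)]] that(2) by blast
  show ?thesis
  proof (intro fig_module.intro fig_module_axioms.intro)
    show "group G" by (rule G.is_group)
    show "cring k" by (rule k.is_cring)
  next
    fix S :: "'x set" assume S: "finite S"
    show "module k (fig_restrict V W S)"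
      using submodule.submodule_is_module[OF sub[OF S] obj[OF S]] by (simp add: fig_restrict_def)
  next
    fix S T :: "'x set" and \<phi>
    assume *: "finite S" "finite T" "\<phi> \<in> fig_hom G S T"
    show "A S T \<phi> \<in> linear_maps k (fig_restrict V W S) (fig_restrict V W T)"
      using mor[OF *] stable[OF *] car[OF *(1)] by (auto simp: linear_maps_def fig_restrict_def)
  next
    fix S :: "'x set" and v
    assume "finite S" "v \<in> carrier (fig_restrict V W S)"
    then show "A S S (fig_id G S) v = v"
      using car by (auto simp: fig_restrict_def intro: map_id)
  next
    fix S T U :: "'x set" and \<psi> \<phi> v
    assume "finite S" "finite T" "finite U" "\<psi> \<in> fig_hom G S T" "\<phi> \<in> fig_hom G T U"
      "v \<in> carrier (fig_restrict V W S)"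
    then show "A S U (fig_comp G S \<phi> \<psi>) v = A T U \<phi> (A S T \<psi> v)"
      using car by (auto simp: fig_restrict_def intro: map_comp)
  qed
qed

end

theory Submission
  imports Defs "HOL-Library.Fun_Lexorder"
begin

text \<open>
  The theorem is a Groebner basis argument over ordered injections.

  Let \<open>OI\<close> be the category of the sets \<open>{0, \<dots>, n - 1}\<close> and strictly increasing maps, embedded in
  \<open>FI\<^sub>G\<close> by decorating every point with \<open>\<one>\<close>. Every morphism \<open>S \<rightarrow> {0, \<dots>, n - 1}\<close> of \<open>FI\<^sub>G\<close> is an
  arbitrary decorated bijection \<open>S \<rightarrow> {0, \<dots>, \<bar>S\<bar> - 1}\<close> followed by a morphism of \<open>OI\<close>
  (\<open>fig_hom_factor\<close>). As \<open>G\<close> is finite, there are only finitely many such bijections. Hence a finitely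
  generated \<open>FI\<^sub>G\<close>-module is still finitely generated over the much smaller category \<open>OI\<close>
  (\<open>order_emb_generators\<close>), and it suffices to find finitely many elements that generate the
  submodule over \<open>OI\<close>.

  Over \<open>OI\<close>, call \<open>V(q) g\<^sub>i\<close> a monomial, where \<open>g\<^sub>i\<close> is one of the generators and \<open>q\<close> a morphism of
  \<open>OI\<close>; the monomials at level \<open>n\<close> are finite in number and span \<open>V({0, \<dots>, n - 1})\<close>. Ordering the
  pairs \<open>(i, q)\<close> lexicographically, the transition maps are strictly increasing on monomials. For a
  submodule \<open>W\<close> and a monomial \<open>x\<close>, the leading coefficients of the elements of \<open>W\<close> of the form
  \<open>c x + lower monomials\<close> form an ideal of \<open>k\<close>, which can only grow when \<open>x\<close> is pushed forward. Three
  facts then finish the proof: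

  \<^item> Divisibility of monomials (\<open>x\<close> divides \<open>y\<close> if \<open>y\<close> is a push-forward of \<open>x\<close>) is a well-quasi-order.
    This is Dickson's lemma, as an increasing sequence of points is determined by its gaps and divides
    another one as soon as its gaps are at most as large (\<open>order_emb_ascending_subsequence\<close>).
  \<^item> For a monotone map from a well-quasi-order to the ideals of a Noetherian ring there is a finite
    set such that every point lies above a point of the set with the same ideal (\<open>finite_ideal_cover\<close>).
    So finitely many elements of \<open>W\<close> determine all its leading ideals.
  \<^item> A submodule of \<open>W\<close> with the same leading ideals as \<open>W\<close> is all of \<open>W\<close>, by cancelling leading terms
    (\<open>subset_if_lead_subset\<close>).

  The generators may satisfy relations, so an element can have many representations by monomials and
  no well-defined leading term. For this reason the leading ideal at \<open>x\<close> consists of the coefficients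
  of \<open>x\<close> in all representations in which \<open>x\<close> is the highest monomial allowed.
\<close>

section \<open>Submodules, spans and linear maps\<close>

lemma (in module) submoduleI_no_inv:
  assumes "H \<subseteq> carrier M" and "\<zero>\<^bsub>M\<^esub> \<in> H"
    and "\<And>x y. \<lbrakk>x \<in> H; y \<in> H\<rbrakk> \<Longrightarrow> x \<oplus>\<^bsub>M\<^esub> y \<in> H"
    and "\<And>a x. \<lbrakk>a \<in> carrier R; x \<in> H\<rbrakk> \<Longrightarrow> a \<odot>\<^bsub>M\<^esub> x \<in> H"
  shows "submodule H R M"
proof (rule submoduleI)
  fix x assume "x \<in> H"
  moreover have "(\<ominus>\<^bsub>R\<^esub> \<one>\<^bsub>R\<^esub>) \<odot>\<^bsub>M\<^esub> x = \<ominus>\<^bsub>M\<^esub> x"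
    using smult_l_minus[of "\<one>\<^bsub>R\<^esub>" x] \<open>x \<in> H\<close> assms(1) by auto
  ultimately show "\<ominus>\<^bsub>M\<^esub> x \<in> H"
    using assms(4)[of "\<ominus>\<^bsub>R\<^esub> \<one>\<^bsub>R\<^esub>" x] by simp
qed (use assms in auto)

lemma (in module) submodule_zero: "submodule H R M \<Longrightarrow> \<zero>\<^bsub>M\<^esub> \<in> H"
  using subgroup.one_closed[OF submodule.axioms(1)] by fastforce

lemma (in module) submodule_minus:
  assumes "submodule H R M" "x \<in> H" "y \<in> H"
  shows "x \<ominus>\<^bsub>M\<^esub> y \<in> H"
  using submoduleE(3,5)[OF assms(1)] assms(2,3) by (simp add: a_minus_def)

definition mspan :: "('k, 'd) ring_scheme \<Rightarrow> ('k, 'v, 'm) module_scheme \<Rightarrow> 'v set \<Rightarrow> 'v set" where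
  "mspan k M B = \<Inter>{N. submodule N k M \<and> B \<subseteq> N}"

lemma mspan_superset: "B \<subseteq> mspan k M B"
  by (auto simp: mspan_def)

lemma mspan_least: "\<lbrakk>submodule N k M; B \<subseteq> N\<rbrakk> \<Longrightarrow> mspan k M B \<subseteq> N"
  by (auto simp: mspan_def)

lemma mspan_mono: "B \<subseteq> C \<Longrightarrow> mspan k M B \<subseteq> mspan k M C"
  by (auto simp: mspan_def)

lemma (in module) mspan_submodule:
  assumes "B \<subseteq> carrier M"
  shows "submodule (mspan R M B) R M"
proof (rule submoduleI_no_inv)
  show "mspan R M B \<subseteq> carrier M"
    using mspan_least[OF carrier_is_submodule assms] .
qed (auto simp: mspan_def submodule_zero submoduleE)

lemma (in module) mspan_carrier:
  "B \<subseteq> carrier M \<Longrightarrow> mspan R M B \<subseteq> carrier M"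
  by (rule mspan_least[OF carrier_is_submodule])

lemma (in module) mspan_empty: "mspan R M {} = {\<zero>\<^bsub>M\<^esub>}"
proof -
  have "submodule {\<zero>\<^bsub>M\<^esub>} R M"
    by (rule submoduleI_no_inv) auto
  then show ?thesis
    using mspan_least[of "{\<zero>\<^bsub>M\<^esub>}" R M "{}"] submodule_zero[OF mspan_submodule[of "{}"]] by auto
qed

lemma (in module) mspan_insertE:
  assumes b: "b \<in> carrier M" and B: "B \<subseteq> carrier M" and w: "w \<in> mspan R M (insert b B)"
  obtains c u where "c \<in> carrier R" "u \<in> mspan R M B" "w = c \<odot>\<^bsub>M\<^esub> b \<oplus>\<^bsub>M\<^esub> u"
proof -
  let ?N = "{c \<odot>\<^bsub>M\<^esub> b \<oplus>\<^bsub>M\<^esub> u | c u. c \<in> carrier R \<and> u \<in> mspan R M B}"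
  note S = mspan_submodule[OF B]
  have car: "u \<in> carrier M" if "u \<in> mspan R M B" for u
    using mspan_carrier[OF B] that by blast
  have "submodule ?N R M"
  proof (rule submoduleI_no_inv)
    show "?N \<subseteq> carrier M"
      using b car by auto
    show "\<zero>\<^bsub>M\<^esub> \<in> ?N"
      using b submodule_zero[OF S] by (intro CollectI exI[of _ "\<zero>\<^bsub>R\<^esub>"] exI[of _ "\<zero>\<^bsub>M\<^esub>"]) auto
  next
    fix x y assume "x \<in> ?N" "y \<in> ?N"
    then obtain c u c' u' where cu: "c \<in> carrier R" "u \<in> mspan R M B" "x = c \<odot>\<^bsub>M\<^esub> b \<oplus>\<^bsub>M\<^esub> u"
      "c' \<in> carrier R" "u' \<in> mspan R M B" "y = c' \<odot>\<^bsub>M\<^esub> b \<oplus>\<^bsub>M\<^esub> u'"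
      by blast
    then have "x \<oplus>\<^bsub>M\<^esub> y = (c \<oplus>\<^bsub>R\<^esub> c') \<odot>\<^bsub>M\<^esub> b \<oplus>\<^bsub>M\<^esub> (u \<oplus>\<^bsub>M\<^esub> u')"
      using b car by (simp add: smult_l_distr M.add.m_ac)
    then show "x \<oplus>\<^bsub>M\<^esub> y \<in> ?N"
      using cu submoduleE(5)[OF S] by blast
  next
    fix a x assume a: "a \<in> carrier R" and "x \<in> ?N"
    then obtain c u where cu: "c \<in> carrier R" "u \<in> mspan R M B" "x = c \<odot>\<^bsub>M\<^esub> b \<oplus>\<^bsub>M\<^esub> u"
      by blast
    then have "a \<odot>\<^bsub>M\<^esub> x = (a \<otimes>\<^bsub>R\<^esub> c) \<odot>\<^bsub>M\<^esub> b \<oplus>\<^bsub>M\<^esub> a \<odot>\<^bsub>M\<^esub> u"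
      using a b car by (simp add: smult_r_distr smult_assoc1)
    then show "a \<odot>\<^bsub>M\<^esub> x \<in> ?N"
      using a cu submoduleE(4)[OF S] by blast
  qed
  moreover have "insert b B \<subseteq> ?N"
  proof -
    have "b = \<one>\<^bsub>R\<^esub> \<odot>\<^bsub>M\<^esub> b \<oplus>\<^bsub>M\<^esub> \<zero>\<^bsub>M\<^esub>"
      using b by simp
    moreover have "x = \<zero>\<^bsub>R\<^esub> \<odot>\<^bsub>M\<^esub> b \<oplus>\<^bsub>M\<^esub> x" if "x \<in> B" for x
      using b B that by auto
    ultimately show ?thesis
      using submodule_zero[OF S] mspan_superset[of B R M] by blast
  qed
  ultimately have "w \<in> ?N"
    using w mspan_least by blast
  then show thesis
    using that by blast
qed

lemma linear_map_zero:
  assumes "module k M" "module k N" "h \<in> linear_maps k M N"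
  shows "h \<zero>\<^bsub>M\<^esub> = \<zero>\<^bsub>N\<^esub>"
proof -
  interpret M: module k M by fact
  interpret N: module k N by fact
  have "h (\<zero>\<^bsub>k\<^esub> \<odot>\<^bsub>M\<^esub> \<zero>\<^bsub>M\<^esub>) = \<zero>\<^bsub>k\<^esub> \<odot>\<^bsub>N\<^esub> h \<zero>\<^bsub>M\<^esub>"
    using assms(3) M.zero_closed M.R.zero_closed unfolding linear_maps_def by blast
  moreover have "h \<zero>\<^bsub>M\<^esub> \<in> carrier N"
    using assms(3) by (auto simp: linear_maps_def)
  ultimately show ?thesis
    by simp
qed

lemma linear_map_mspan:
  assumes "module k M" "module k N" and h: "h \<in> linear_maps k M N"
    and B: "B \<subseteq> carrier M" and C: "C \<subseteq> carrier N" and BC: "h ` B \<subseteq> mspan k N C"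
  shows "h ` mspan k M B \<subseteq> mspan k N C"
proof -
  interpret M: module k M by fact
  interpret N: module k N by fact
  note S = N.mspan_submodule[OF C]
  have "submodule {x \<in> carrier M. h x \<in> mspan k N C} k M"
  proof (rule M.submoduleI_no_inv)
    show "\<zero>\<^bsub>M\<^esub> \<in> {x \<in> carrier M. h x \<in> mspan k N C}"
      using linear_map_zero[OF assms(1,2) h] N.submodule_zero[OF S] by simp
  qed (use h N.submoduleE(4,5)[OF S] in \<open>auto simp: linear_maps_def\<close>)
  then have "mspan k M B \<subseteq> {x \<in> carrier M. h x \<in> mspan k N C}"
    by (rule mspan_least) (use B BC in auto)
  then show ?thesis
    by blast
qed

section \<open>Leading ideals over a Noetherian ring\<close>

text \<open>
  If no finite set served, one could choose a sequence in which no term has an earlier term below it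
  with the same ideal. Along an ascending subsequence the ideals form an ascending chain; where
  the chain becomes stationary, two consecutive terms violate the choice.
\<close>

lemma finite_ideal_cover:
  fixes I :: "'b \<Rightarrow> 'k set"
  assumes "noetherian_ring k"
    and sub: "\<And>s :: nat \<Rightarrow> 'b. (\<And>j. s j \<in> X) \<Longrightarrow>
      \<exists>r :: nat \<Rightarrow> nat. strict_mono r \<and> (\<forall>i j. i < j \<longrightarrow> below (s (r i)) (s (r j)))"
    and ideal: "\<And>x. x \<in> X \<Longrightarrow> ideal (I x) k"
    and mono: "\<And>x y. \<lbrakk>x \<in> X; y \<in> X; below x y\<rbrakk> \<Longrightarrow> I x \<subseteq> I y"
  shows "\<exists>F. finite F \<and> F \<subseteq> X \<and> (\<forall>x\<in>X. \<exists>y\<in>F. below y x \<and> I y = I x)"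
proof (rule ccontr)
  assume "\<not> ?thesis"
  then have ex: "\<exists>x\<in>X. \<forall>y\<in>F. \<not> (below y x \<and> I y = I x)" if "finite F" "F \<subseteq> X" for F
    using that by meson
  have "\<exists>s :: nat \<Rightarrow> 'b. \<forall>n. s n \<in> X \<and> (\<forall>m<n. \<not> (below (s m) (s n) \<and> I (s m) = I (s n)))"
  proof (rule dependent_wellorder_choice[where P =
      "\<lambda>s n x. x \<in> X \<and> (\<forall>m<n. \<not> (below (s m) x \<and> I (s m) = I x))"])
    fix n :: nat and x :: 'b and s t :: "nat \<Rightarrow> 'b"
    assume "\<And>m. m < n \<Longrightarrow> s m = t m"
    then show "(x \<in> X \<and> (\<forall>m<n. \<not> (below (s m) x \<and> I (s m) = I x))) =
        (x \<in> X \<and> (\<forall>m<n. \<not> (below (t m) x \<and> I (t m) = I x)))"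
      by metis
  next
    fix n :: nat and s :: "nat \<Rightarrow> 'b"
    assume "\<And>m. m < n \<Longrightarrow> s m \<in> X \<and> (\<forall>i<m. \<not> (below (s i) (s m) \<and> I (s i) = I (s m)))"
    then have "\<exists>x\<in>X. \<forall>y\<in>s ` {..<n}. \<not> (below y x \<and> I y = I x)"
      by (intro ex) auto
    then show "\<exists>x. x \<in> X \<and> (\<forall>m<n. \<not> (below (s m) x \<and> I (s m) = I x))"
      by blast
  qed
  then obtain s :: "nat \<Rightarrow> 'b" where s: "\<And>n. s n \<in> X"
    "\<And>m n. m < n \<Longrightarrow> \<not> (below (s m) (s n) \<and> I (s m) = I (s n))"
    by blast
  obtain r :: "nat \<Rightarrow> nat" where r: "strict_mono r" "\<And>i j. i < j \<Longrightarrow> below (s (r i)) (s (r j))"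
    using sub s(1) by metis
  let ?C = "range (\<lambda>i. I (s (r i)))"
  have incr: "I (s (r i)) \<subseteq> I (s (r j))" if "i \<le> j" for i j
    using that mono[OF s(1) s(1) r(2)] by (cases "i = j") auto
  have "subset.chain {I. ideal I k} ?C"
    unfolding subset_chain_def
  proof (intro conjI ballI)
    fix J J' assume "J \<in> ?C" "J' \<in> ?C"
    then obtain i j where "J = I (s (r i))" "J' = I (s (r j))"
      by blast
    then show "J \<subseteq> J' \<or> J' \<subseteq> J"
      using incr linear[of i j] by blast
  qed (use ideal s(1) in auto)
  then have "\<Union>?C \<in> ?C"
    by (intro noetherian_ring.ideal_chain_is_trivial[OF assms(1)]) auto
  then obtain i where i: "\<Union>?C = I (s (r i))"
    by blast
  have "I (s (r (Suc i))) \<subseteq> \<Union>?C"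
    by blast
  then have "I (s (r (Suc i))) = I (s (r i))"
    unfolding i using incr[of i "Suc i"] by simp
  then show False
    using s(2)[OF strict_monoD[OF r(1) lessI[of i]]] r(2)[OF lessI[of i]] by simp
qed

text \<open>
  The data of a Groebner basis argument: modules \<open>M n\<close> spanned by finitely many ordered monomials,
  and transition maps \<open>act m n h\<close> that send monomials to monomials and preserve their order. The
  monomials \<open>x \<in> X n\<close> are labels and \<open>e n x\<close> is the element that they stand for; different labels may
  stand for the same element. The last axiom says that divisibility is a well-quasi-order.
\<close>

locale monomial_system =
  fixes k :: "('k, 'd) ring_scheme"
    and M :: "'n \<Rightarrow> ('k, 'v, 'm) module_scheme"
    and X :: "'n \<Rightarrow> 'b set"
    and e :: "'n \<Rightarrow> 'b \<Rightarrow> 'v"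
    and less :: "'b \<Rightarrow> 'b \<Rightarrow> bool"
    and H :: "'n \<Rightarrow> 'n \<Rightarrow> 'h set"
    and act :: "'n \<Rightarrow> 'n \<Rightarrow> 'h \<Rightarrow> 'v \<Rightarrow> 'v"
    and push :: "'h \<Rightarrow> 'b \<Rightarrow> 'b"
  assumes noetherian: "noetherian_ring k"
    and module: "module k (M n)"
    and finite_monomials: "finite (X n)"
    and e_carrier: "x \<in> X n \<Longrightarrow> e n x \<in> carrier (M n)"
    and spanning: "carrier (M n) \<subseteq> mspan k (M n) (e n ` X n)"
    and less_trans: "transp less"
    and less_asym: "asymp less"
    and less_total: "\<lbrakk>x \<in> X n; y \<in> X n; x \<noteq> y\<rbrakk> \<Longrightarrow> less x y \<or> less y x"
    and act_linear: "h \<in> H m n \<Longrightarrow> act m n h \<in> linear_maps k (M m) (M n)"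
    and push_in: "\<lbrakk>h \<in> H m n; x \<in> X m\<rbrakk> \<Longrightarrow> push h x \<in> X n"
    and act_e: "\<lbrakk>h \<in> H m n; x \<in> X m\<rbrakk> \<Longrightarrow> act m n h (e m x) = e n (push h x)"
    and push_mono: "\<lbrakk>h \<in> H m n; x \<in> X m; y \<in> X m; less x y\<rbrakk> \<Longrightarrow> less (push h x) (push h y)"
    and ascending_subsequence: "(\<And>j. xs j \<in> X (ns j)) \<Longrightarrow>
      \<exists>r :: nat \<Rightarrow> nat. strict_mono r \<and>
        (\<forall>i j. i < j \<longrightarrow> (\<exists>h \<in> H (ns (r i)) (ns (r j)). push h (xs (r i)) = xs (r j)))"
begin

definition lower :: "'n \<Rightarrow> 'b \<Rightarrow> 'v set" where
  "lower n x = mspan k (M n) (e n ` {y \<in> X n. less y x})"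

text \<open>
  The ideal of leading coefficients at \<open>x\<close>. An element of \<open>W n\<close> may contribute several coefficients,
  as its representation by monomials is not unique.
\<close>

definition lead :: "('n \<Rightarrow> 'v set) \<Rightarrow> 'n \<Rightarrow> 'b \<Rightarrow> 'k set" where
  "lead W n x = {c \<in> carrier k. \<exists>u \<in> lower n x. c \<odot>\<^bsub>M n\<^esub> e n x \<oplus>\<^bsub>M n\<^esub> u \<in> W n}"

definition stable :: "('n \<Rightarrow> 'v set) \<Rightarrow> bool" where
  "stable W \<longleftrightarrow> (\<forall>n. submodule (W n) k (M n)) \<and> (\<forall>m n. \<forall>h\<in>H m n. act m n h ` W m \<subseteq> W n)"

lemma e_image: "Y \<subseteq> X n \<Longrightarrow> e n ` Y \<subseteq> carrier (M n)"
  using e_carrier by blast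

lemma lower_submodule: "submodule (lower n x) k (M n)"
  unfolding lower_def by (intro module.mspan_submodule[OF module] e_image) auto

lemma lead_ideal:
  assumes W: "submodule (W n) k (M n)" and x: "x \<in> X n"
  shows "ideal (lead W n x) k"
proof -
  interpret module k "M n" by (rule module)
  have car: "u \<in> carrier (M n)" if "u \<in> lower n x" for u
    using submoduleE(1)[OF lower_submodule] that by blast
  note e = e_carrier[OF x]
  have smult: "a \<otimes>\<^bsub>k\<^esub> c \<in> lead W n x" if a: "a \<in> carrier k" and c: "c \<in> lead W n x" for a c
  proof -
    obtain u where u: "c \<in> carrier k" "u \<in> lower n x" "c \<odot>\<^bsub>M n\<^esub> e n x \<oplus>\<^bsub>M n\<^esub> u \<in> W n"
      using c by (auto simp: lead_def)
    then have "(a \<otimes>\<^bsub>k\<^esub> c) \<odot>\<^bsub>M n\<^esub> e n x \<oplus>\<^bsub>M n\<^esub> a \<odot>\<^bsub>M n\<^esub> u = a \<odot>\<^bsub>M n\<^esub> (c \<odot>\<^bsub>M n\<^esub> e n x \<oplus>\<^bsub>M n\<^esub> u)"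
      using a e car by (simp add: smult_r_distr smult_assoc1)
    then show ?thesis
      using a u submoduleE(4)[OF W a] submoduleE(4)[OF lower_submodule a]
      by (auto simp: lead_def intro!: bexI[of _ "a \<odot>\<^bsub>M n\<^esub> u"])
  qed
  show ?thesis
  proof (rule idealI)
    show "subgroup (lead W n x) (add_monoid k)"
    proof (rule R.add.subgroupI)
      show "lead W n x \<subseteq> carrier k"
        by (auto simp: lead_def)
      have "\<zero>\<^bsub>k\<^esub> \<in> lead W n x"
        using e submodule_zero[OF W] submodule_zero[OF lower_submodule]
        by (auto simp: lead_def intro!: bexI[of _ "\<zero>\<^bsub>M n\<^esub>"])
      then show "lead W n x \<noteq> {}"
        by blast
    next
      fix c assume c: "c \<in> lead W n x"
      then have "(\<ominus>\<^bsub>k\<^esub> \<one>\<^bsub>k\<^esub>) \<otimes>\<^bsub>k\<^esub> c = \<ominus>\<^bsub>k\<^esub> c"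
        by (simp add: lead_def R.l_minus)
      then show "\<ominus>\<^bsub>k\<^esub> c \<in> lead W n x"
        using smult[OF _ c, of "\<ominus>\<^bsub>k\<^esub> \<one>\<^bsub>k\<^esub>"] by simp
    next
      fix c c' assume "c \<in> lead W n x" "c' \<in> lead W n x"
      then obtain u u' where u: "c \<in> carrier k" "u \<in> lower n x" "c \<odot>\<^bsub>M n\<^esub> e n x \<oplus>\<^bsub>M n\<^esub> u \<in> W n"
        "c' \<in> carrier k" "u' \<in> lower n x" "c' \<odot>\<^bsub>M n\<^esub> e n x \<oplus>\<^bsub>M n\<^esub> u' \<in> W n"
        by (auto simp: lead_def)
      then have "(c \<oplus>\<^bsub>k\<^esub> c') \<odot>\<^bsub>M n\<^esub> e n x \<oplus>\<^bsub>M n\<^esub> (u \<oplus>\<^bsub>M n\<^esub> u') =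
        (c \<odot>\<^bsub>M n\<^esub> e n x \<oplus>\<^bsub>M n\<^esub> u) \<oplus>\<^bsub>M n\<^esub> (c' \<odot>\<^bsub>M n\<^esub> e n x \<oplus>\<^bsub>M n\<^esub> u')"
        using e car by (simp add: smult_l_distr M.add.m_ac)
      then show "c \<oplus>\<^bsub>k\<^esub> c' \<in> lead W n x"
        using u submoduleE(5)[OF W] submoduleE(5)[OF lower_submodule]
        by (auto simp: lead_def intro!: bexI[of _ "u \<oplus>\<^bsub>M n\<^esub> u'"])
    qed
  next
    fix a c assume *: "a \<in> lead W n x" "c \<in> carrier k"
    then show "c \<otimes>\<^bsub>k\<^esub> a \<in> lead W n x"
      by (intro smult)
    with * show "a \<otimes>\<^bsub>k\<^esub> c \<in> lead W n x"
      by (simp add: lead_def R.m_comm)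
  qed (rule R.ring_axioms)
qed

text \<open>
  Applying a transition map to \<open>c x + lower\<close> gives \<open>c (push h x) + lower\<close>, since the map preserves the
  order of monomials.
\<close>

lemma lead_push:
  assumes W: "stable W" and h: "h \<in> H m n" and x: "x \<in> X m"
  shows "lead W m x \<subseteq> lead W n (push h x)"
proof
  fix c assume "c \<in> lead W m x"
  then obtain u where c: "c \<in> carrier k" and u: "u \<in> lower m x"
    and w: "c \<odot>\<^bsub>M m\<^esub> e m x \<oplus>\<^bsub>M m\<^esub> u \<in> W m"
    by (auto simp: lead_def)
  have "act m n h ` lower m x \<subseteq> lower n (push h x)"
    unfolding lower_def
    using h x by (intro linear_map_mspan module act_linear e_image image_subsetI)
      (auto simp: act_e intro!: subsetD[OF mspan_superset] imageI push_in push_mono)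
  then have u': "act m n h u \<in> lower n (push h x)"
    using u by blast
  interpret M: module k "M m" by (rule module)
  have "u \<in> carrier (M m)"
    using M.submoduleE(1)[OF lower_submodule] u by blast
  then have "act m n h (c \<odot>\<^bsub>M m\<^esub> e m x \<oplus>\<^bsub>M m\<^esub> u) =
      c \<odot>\<^bsub>M n\<^esub> e n (push h x) \<oplus>\<^bsub>M n\<^esub> act m n h u"
    using act_linear[OF h] c e_carrier[OF x] act_e[OF h x] by (simp add: linear_maps_def)
  then have "c \<odot>\<^bsub>M n\<^esub> e n (push h x) \<oplus>\<^bsub>M n\<^esub> act m n h u \<in> W n"
    using W h w unfolding stable_def by (metis image_subset_iff)
  then show "c \<in> lead W n (push h x)"
    using c u' by (auto simp: lead_def)
qed

text \<open>
  Reduction: an element of \<open>W n\<close> with leading term \<open>c b\<close> differs from some element of \<open>W' n\<close> with the same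
  leading term by an element of \<open>W n\<close> that involves only monomials below \<open>b\<close>. The induction runs over
  the sets \<open>D\<close> of monomials that are closed downwards, so that the monomials below the largest
  element \<open>b\<close> of \<open>D\<close> are exactly those of \<open>D - {b}\<close>.
\<close>

lemma subset_if_lead_subset:
  assumes W: "submodule (W n) k (M n)" and W': "submodule (W' n) k (M n)" and sub: "W' n \<subseteq> W n"
    and lead: "\<And>x. x \<in> X n \<Longrightarrow> lead W n x \<subseteq> lead W' n x"
  shows "W n \<subseteq> W' n"
proof -
  interpret module k "M n" by (rule module)
  have "W n \<inter> mspan k (M n) (e n ` D) \<subseteq> W' n"
    if "D \<subseteq> X n" and "\<And>x y. \<lbrakk>x \<in> D; y \<in> X n; less y x\<rbrakk> \<Longrightarrow> y \<in> D" for D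
    using that
  proof (induction "card D" arbitrary: D rule: less_induct)
    case less
    have "finite D"
      using less.prems(1) finite_monomials finite_subset by blast
    show ?case
    proof (cases "D = {}")
      case True
      then show ?thesis
        using mspan_empty submodule_zero[OF W'] by auto
    next
      case False
      obtain b where b: "b \<in> D" "\<And>x. x \<in> D \<Longrightarrow> x \<noteq> b \<Longrightarrow> \<not> less b x"
        using Finite_Set.bex_max_element[OF \<open>finite D\<close> _ _ False] less_trans less_asym
        by (metis asymp_on_subset subset_UNIV transp_on_subset)
      let ?D = "{y \<in> X n. less y b}"
      have bX: "b \<in> X n"
        using b(1) less.prems(1) by blast
      have nb: "\<not> less b b"
        using less_asym by (auto simp: asymp_on_def)
      have D: "D = insert b ?D"
        using b less_total[of _ n b] less.prems bX by blast
      show ?thesis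
      proof
        fix w assume w: "w \<in> W n \<inter> mspan k (M n) (e n ` D)"
        obtain c u where cu: "c \<in> carrier k" "u \<in> lower n b" "w = c \<odot>\<^bsub>M n\<^esub> e n b \<oplus>\<^bsub>M n\<^esub> u"
          using mspan_insertE[of "e n b" "e n ` ?D" w] w D e_carrier[OF bX] e_image[of ?D n]
          unfolding lower_def by (metis (no_types, lifting) IntD2 image_insert mem_Collect_eq subsetI)
        then have "c \<in> lead W n b"
          using w by (auto simp: lead_def)
        then obtain u' where u': "u' \<in> lower n b" "c \<odot>\<^bsub>M n\<^esub> e n b \<oplus>\<^bsub>M n\<^esub> u' \<in> W' n"
          using lead[OF bX] by (auto simp: lead_def)
        define w' where "w' = c \<odot>\<^bsub>M n\<^esub> e n b \<oplus>\<^bsub>M n\<^esub> u'"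
        have car: "v \<in> carrier (M n)" if "v \<in> lower n b" for v
          using submoduleE(1)[OF lower_submodule] that by blast
        have wcar: "w \<in> carrier (M n)" "w' \<in> carrier (M n)"
          using w u' submoduleE(1)[OF W] submoduleE(1)[OF W'] w'_def by auto
        have "w \<ominus>\<^bsub>M n\<^esub> w' = u \<ominus>\<^bsub>M n\<^esub> u'"
        proof -
          have "w \<ominus>\<^bsub>M n\<^esub> w' = (c \<odot>\<^bsub>M n\<^esub> e n b \<oplus>\<^bsub>M n\<^esub> \<ominus>\<^bsub>M n\<^esub> (c \<odot>\<^bsub>M n\<^esub> e n b)) \<oplus>\<^bsub>M n\<^esub> (u \<oplus>\<^bsub>M n\<^esub> \<ominus>\<^bsub>M n\<^esub> u')"
            unfolding w'_def cu(3) a_minus_def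
            using cu(1,2) u'(1) e_carrier[OF bX] car by (simp add: M.minus_add M.add.m_ac del: M.r_neg)
          then show ?thesis
            using cu(1,2) u'(1) e_carrier[OF bX] car by (simp add: a_minus_def M.r_neg)
        qed
        then have "w \<ominus>\<^bsub>M n\<^esub> w' \<in> lower n b"
          using submodule_minus[OF lower_submodule cu(2) u'(1)] by simp
        moreover have "w \<ominus>\<^bsub>M n\<^esub> w' \<in> W n"
          using submodule_minus[OF W, of w w'] w u'(2) sub w'_def by auto
        moreover have "W n \<inter> mspan k (M n) (e n ` ?D) \<subseteq> W' n"
        proof (rule less.hyps)
          show "card ?D < card D"
            using \<open>finite D\<close> b(1) D nb by (intro psubset_card_mono) auto
        qed (use less_trans in \<open>auto dest: transpD\<close>)
        ultimately have "w \<ominus>\<^bsub>M n\<^esub> w' \<in> W' n"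
          by (auto simp: lower_def)
        then have "(w \<ominus>\<^bsub>M n\<^esub> w') \<oplus>\<^bsub>M n\<^esub> w' \<in> W' n"
          using submoduleE(5)[OF W'] u'(2) w'_def by blast
        moreover have "(w \<ominus>\<^bsub>M n\<^esub> w') \<oplus>\<^bsub>M n\<^esub> w' = w"
          using wcar by (simp add: a_minus_def M.a_assoc M.l_neg)
        ultimately show "w \<in> W' n"
          by simp
      qed
    qed
  qed
  from this[of "X n"] show ?thesis
    using spanning[of n] submoduleE(1)[OF W] by blast
qed

text \<open>
  Finitely many monomials in \<open>F\<close> account for all leading ideals of \<open>W\<close>. For each of them, \<open>E\<close> contains
  one element of \<open>W\<close> for each member of a finite generating set of its leading ideal. The leading ideals
  of a stable \<open>W'\<close> that contains \<open>E\<close> then contain those of \<open>W\<close>, first at \<open>F\<close> and, by pushing forward,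
  everywhere.
\<close>

theorem stable_finitely_generated:
  assumes W: "stable W"
  shows "\<exists>E. finite E \<and> (\<forall>(n, w)\<in>E. w \<in> W n) \<and>
    (\<forall>W'. stable W' \<longrightarrow> (\<forall>n. W' n \<subseteq> W n) \<longrightarrow> (\<forall>(n, w)\<in>E. w \<in> W' n) \<longrightarrow> W' = W)"
proof -
  define below where "below = (\<lambda>(m, x) (n, y). \<exists>h\<in>H m n. push h x = y)"
  define L where "L = (\<lambda>(n, x). lead W n x)"
  have "\<exists>F. finite F \<and> F \<subseteq> Sigma UNIV X \<and> (\<forall>y\<in>Sigma UNIV X.
      \<exists>x\<in>F. below x y \<and> L x = L y)"
  proof (rule finite_ideal_cover[OF noetherian, of "Sigma UNIV X" below L])
    fix s :: "nat \<Rightarrow> 'n \<times> 'b"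
    assume s: "\<And>j. s j \<in> Sigma UNIV X"
    have "snd (s j) \<in> X (fst (s j))" for j
      using s[of j] by (cases "s j") auto
    then show "\<exists>r :: nat \<Rightarrow> nat. strict_mono r \<and> (\<forall>i j. i < j \<longrightarrow> below (s (r i)) (s (r j)))"
      using ascending_subsequence[of "\<lambda>j. snd (s j)" "\<lambda>j. fst (s j)"]
      by (simp add: below_def case_prod_beta)
  next
    fix x y assume "x \<in> Sigma UNIV X" "below x y"
    then show "L x \<subseteq> L y"
      by (cases x; cases y) (auto simp: below_def L_def dest!: subsetD[OF lead_push[OF W]])
  qed (use lead_ideal W in \<open>auto simp: stable_def L_def\<close>)
  then obtain F where F: "finite F" "F \<subseteq> Sigma UNIV X"
    "\<forall>y\<in>Sigma UNIV X. \<exists>x\<in>F. below x y \<and> L x = L y"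
    by (elim exE conjE)
  have "\<forall>y\<in>F. \<exists>C. finite C \<and> lead W (fst y) (snd y) = genideal k C \<and> C \<subseteq> lead W (fst y) (snd y)"
  proof
    fix y assume "y \<in> F"
    then have "ideal (lead W (fst y) (snd y)) k"
      using F(2) lead_ideal W by (auto simp: stable_def)
    then show "\<exists>C. finite C \<and> lead W (fst y) (snd y) = genideal k C \<and> C \<subseteq> lead W (fst y) (snd y)"
      using noetherian_ring.finetely_gen[OF noetherian] noetherian_ring.axioms(1)[OF noetherian]
        ring.genideal_self by metis
  qed
  then obtain C where C: "\<And>y. y \<in> F \<Longrightarrow> finite (C y)"
    "\<And>y. y \<in> F \<Longrightarrow> lead W (fst y) (snd y) = genideal k (C y)"
    "\<And>y. y \<in> F \<Longrightarrow> C y \<subseteq> lead W (fst y) (snd y)"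
    by metis
  have "\<exists>u. u \<in> lower (fst y) (snd y) \<and>
      c \<odot>\<^bsub>M (fst y)\<^esub> e (fst y) (snd y) \<oplus>\<^bsub>M (fst y)\<^esub> u \<in> W (fst y)" if "y \<in> F" "c \<in> C y" for y c
    using C(3)[OF that(1)] that(2) by (auto simp: lead_def)
  then obtain u where u: "\<And>y c. \<lbrakk>y \<in> F; c \<in> C y\<rbrakk> \<Longrightarrow> u y c \<in> lower (fst y) (snd y) \<and>
      c \<odot>\<^bsub>M (fst y)\<^esub> e (fst y) (snd y) \<oplus>\<^bsub>M (fst y)\<^esub> u y c \<in> W (fst y)"
    by metis
  define E where "E = (\<Union>y\<in>F. \<Union>c\<in>C y.
    {(fst y, c \<odot>\<^bsub>M (fst y)\<^esub> e (fst y) (snd y) \<oplus>\<^bsub>M (fst y)\<^esub> u y c)})"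
  show ?thesis
  proof (intro exI[of _ E] conjI allI impI)
    show "finite E"
      using F(1) C(1) by (auto simp: E_def)
    show "\<forall>(n, w)\<in>E. w \<in> W n"
      using u by (auto simp: E_def)
  next
    fix W'
    assume W': "stable W'" and sub: "\<forall>n. W' n \<subseteq> W n" and E: "\<forall>(n, w)\<in>E. w \<in> W' n"
    have "lead W n y \<subseteq> lead W' n y" if y: "y \<in> X n" for n y
    proof -
      obtain m x h where x: "(m, x) \<in> F" and h: "h \<in> H m n" "push h x = y"
        and eq: "lead W m x = lead W n y"
        using bspec[OF F(3), of "(n, y)"] y by (auto simp: below_def L_def)
      have xX: "x \<in> X m"
        using F(2) x by auto
      have "C (m, x) \<subseteq> lead W' m x"
      proof
        fix c assume c: "c \<in> C (m, x)"
        then have "(m, c \<odot>\<^bsub>M m\<^esub> e m x \<oplus>\<^bsub>M m\<^esub> u (m, x) c) \<in> E"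
          using x by (force simp: E_def)
        then have "c \<odot>\<^bsub>M m\<^esub> e m x \<oplus>\<^bsub>M m\<^esub> u (m, x) c \<in> W' m"
          using E by blast
        moreover have "c \<in> carrier k"
          using C(3)[OF x] c by (auto simp: lead_def)
        ultimately show "c \<in> lead W' m x"
          using u[OF x c] by (auto simp: lead_def)
      qed
      then have "lead W m x \<subseteq> lead W' m x"
        using C(2)[OF x] W' xX
        by (simp add: stable_def lead_ideal ring.genideal_minimal[OF noetherian_ring.axioms(1)[OF noetherian]])
      also have "\<dots> \<subseteq> lead W' n y"
        using lead_push[OF W' h(1) xX] h(2) by simp
      finally show ?thesis
        using eq by simp
    qed
    then have "W n \<subseteq> W' n" for n
      using subset_if_lead_subset[of W n W'] W W' sub by (simp add: stable_def)
    with sub show "W' = W"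
      by (intro ext) blast
  qed
qed

end

section \<open>Ordered injections\<close>

text \<open>
  The strictly increasing maps \<open>{0, \<dots>, m - 1} \<rightarrow> {0, \<dots>, n - 1}\<close>. Each is represented by its extension to
  all natural numbers that maps \<open>m, m + 1, \<dots>\<close> to \<open>n, n + 1, \<dots>\<close>. Then composition is composition of
  functions, equality is equality of functions, and the bound \<open>n\<close> is itself a value, so that
  the gap between the last point and \<open>n\<close> is treated like all other gaps.
\<close>

definition order_emb :: "nat \<Rightarrow> nat \<Rightarrow> (nat \<Rightarrow> nat) set" where
  "order_emb m n = {h. strict_mono h \<and> (\<forall>s. h (m + s) = n + s)}"

lemma order_emb_strict_mono: "h \<in> order_emb m n \<Longrightarrow> strict_mono h"
  by (simp add: order_emb_def)

lemma order_emb_shift: "h \<in> order_emb m n \<Longrightarrow> h (m + s) = n + s"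
  by (simp add: order_emb_def)

lemma order_emb_beyond: "\<lbrakk>h \<in> order_emb m n; m \<le> i\<rbrakk> \<Longrightarrow> h i = n + (i - m)"
  using order_emb_shift[of h m n "i - m"] by simp

lemma order_emb_less: "\<lbrakk>h \<in> order_emb m n; i < m\<rbrakk> \<Longrightarrow> h i < n"
  using strict_monoD[OF order_emb_strict_mono, of h m n i m] order_emb_beyond[of h m n m] by simp

lemma order_emb_comp: "\<lbrakk>h \<in> order_emb m n; q \<in> order_emb d m\<rbrakk> \<Longrightarrow> h \<circ> q \<in> order_emb d n"
  by (simp add: order_emb_def strict_mono_o)

lemma finite_order_emb: "finite (order_emb m n)"
proof (rule finite_imageD)
  show "finite ((\<lambda>h. restrict h {..<m}) ` order_emb m n)"
    by (rule finite_subset[of _ "{..<m} \<rightarrow>\<^sub>E {..<n}"]) (auto intro!: finite_PiE dest: order_emb_less split: if_splits)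
  show "inj_on (\<lambda>h. restrict h {..<m}) (order_emb m n)"
  proof (rule inj_onI, rule ext)
    fix h h' i assume *: "h \<in> order_emb m n" "h' \<in> order_emb m n" "restrict h {..<m} = restrict h' {..<m}"
    show "h i = h' i"
    proof (cases "i < m")
      case True
      with fun_cong[OF *(3), of i] show ?thesis
        by simp
    next
      case False
      with *(1,2) show ?thesis
        by (simp add: order_emb_beyond)
    qed
  qed
qed

lemma less_fun_comp: "\<lbrakk>strict_mono h; less_fun q q'\<rbrakk> \<Longrightarrow> less_fun (h \<circ> q) (h \<circ> q')"
  by (auto simp: less_fun_def strict_mono_less)

lemma less_fun_order_emb_total:
  assumes "q \<in> order_emb d n" "q' \<in> order_emb d n" "q \<noteq> q'"
  shows "less_fun q q' \<or> less_fun q' q"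
proof -
  have "q t = q' t" if "d \<le> t" for t
    using assms(1,2) that by (simp add: order_emb_beyond)
  then have "{t. q t \<noteq> q' t} \<subseteq> {..<d}"
    by (auto simp: not_le[symmetric])
  then have "finite {t. q t \<noteq> q' t}"
    by (rule finite_subset) simp
  then show ?thesis
    using less_fun_trichotomy assms(3) by blast
qed

text \<open>
  The map \<open>h\<close> moves \<open>x\<close> by the displacement \<open>q' t - q t\<close> of the first value \<open>q t\<close> that is at least \<open>x\<close>.
  The assumption on the gaps says that these displacements do not decrease with \<open>t\<close>, hence \<open>h\<close> is
  strictly increasing.
\<close>

lemma order_emb_factor:
  assumes q: "q \<in> order_emb d n" and q': "q' \<in> order_emb d n'"
    and start: "q 0 \<le> q' 0" and gaps: "\<And>t. q (Suc t) - q t \<le> q' (Suc t) - q' t"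
  shows "\<exists>h\<in>order_emb n n'. h \<circ> q = q'"
proof -
  have sm: "strict_mono q" "strict_mono q'"
    using q q' by (auto simp: order_emb_def)
  define \<delta> where "\<delta> t = q' t - q t" for t
  have step: "q t < q (Suc t)" "q' t < q' (Suc t)" for t
    using sm by (auto simp: strict_mono_Suc_iff)
  have le: "q t \<le> q' t" for t
  proof (induction t)
    case (Suc t)
    then show ?case
      using gaps[of t] step[of t] by linarith
  qed (rule start)
  have "incseq \<delta>"
  proof (rule incseq_SucI)
    fix t show "\<delta> t \<le> \<delta> (Suc t)"
      using gaps[of t] step[of t] le[of t] le[of "Suc t"] unfolding \<delta>_def by linarith
  qed
  define b where "b x = (LEAST t. x \<le> q t)" for x
  have b: "x \<le> q (b x)" for x
    unfolding b_def using strict_mono_imp_increasing[OF sm(1), of x] by (rule LeastI)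
  have b_least: "b x \<le> t" if "x \<le> q t" for x t
    unfolding b_def using that by (rule Least_le)
  have bq: "b (q t) = t" for t
    using b[of "q t"] b_least[of "q t" t] sm(1) by (simp add: strict_mono_less_eq)
  define h where "h x = x + \<delta> (b x)" for x
  have hq: "h (q t) = q' t" for t
    using le[of t] by (simp add: h_def bq \<delta>_def)
  have "h x < h y" if "x < y" for x y
  proof -
    have "b x \<le> b y"
      using b[of y] that by (intro b_least) simp
    then have "\<delta> (b x) \<le> \<delta> (b y)"
      by (rule incseqD[OF \<open>incseq \<delta>\<close>])
    with that show ?thesis
      by (simp add: h_def)
  qed
  then have "strict_mono h"
    by (rule strict_monoI)
  moreover have "h (n + s) = n' + s" for s
    using hq[of "d + s"] q q' by (simp add: order_emb_def)
  moreover have "h \<circ> q = q'"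
    using hq by auto
  ultimately show ?thesis
    by (auto simp: order_emb_def)
qed

text \<open>
  The map is the increasing enumeration of \<open>Y \<union> {n, n + 1, \<dots>}\<close>.
\<close>

lemma order_emb_onto:
  assumes "Y \<subseteq> {..<n}"
  obtains h where "h \<in> order_emb (card Y) n" "h ` {..<card Y} = Y"
proof -
  let ?U = "Y \<union> {n..}"
  have inf: "infinite ?U"
    by (simp add: infinite_Ici)
  define h where "h = enumerate ?U"
  have sm: "strict_mono h"
    using inf by (auto simp: h_def intro: strict_monoI enumerate_mono)
  have range: "range h = ?U"
    using bij_enumerate[OF inf] by (simp add: h_def bij_betw_def)
  have img: "h ` {..<t} = ?U \<inter> {..<h t}" for t
  proof
    show "h ` {..<t} \<subseteq> ?U \<inter> {..<h t}"
      using sm range by (auto simp: strict_mono_less)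
    show "?U \<inter> {..<h t} \<subseteq> h ` {..<t}"
    proof
      fix u assume "u \<in> ?U \<inter> {..<h t}"
      then obtain i where "u = h i" "h i < h t"
        unfolding range[symmetric] by auto
      then show "u \<in> h ` {..<t}"
        using sm by (simp add: strict_mono_less)
    qed
  qed
  \<comment> \<open>The number of values below \<open>n + s\<close> is \<open>card Y + s\<close>, and the value at position \<open>t\<close> has
     exactly \<open>t\<close> values below it.\<close>
  have val: "h (card Y + s) = n + s" for s
  proof -
    have "n + s \<in> range h"
      unfolding range by simp
    then obtain t where t: "h t = n + s"
      by auto
    have "h ` {..<t} = Y \<union> {n..<n + s}"
      using img[of t] assms by (auto simp: t)
    moreover have "card (h ` {..<t}) = t"
      using sm by (subst card_image) (auto dest: strict_mono_imp_inj_on inj_on_subset)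
    moreover have "card (Y \<union> {n..<n + s}) = card Y + s"
      using assms finite_subset[OF assms] by (subst card_Un_disjoint) auto
    ultimately show ?thesis
      using t by simp
  qed
  show thesis
  proof
    show "h \<in> order_emb (card Y) n"
      using sm val by (simp add: order_emb_def)
    show "h ` {..<card Y} = Y"
      using img[of "card Y"] val[of 0] assms by auto
  qed
qed

text \<open>
  A sequence has a monotone subsequence. If that one is decreasing, it is constant from some point on,
  as natural numbers cannot decrease forever.
\<close>

lemma incseq_subsequence:
  fixes s :: "nat \<Rightarrow> nat"
  shows "\<exists>r :: nat \<Rightarrow> nat. strict_mono r \<and> incseq (s \<circ> r)"
proof -
  obtain r :: "nat \<Rightarrow> nat" where r: "strict_mono r" "monoseq (\<lambda>i. s (r i))"
    using seq_monosub by blast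
  show ?thesis
  proof (cases "incseq (\<lambda>i. s (r i))")
    case True
    with r(1) show ?thesis
      by (auto simp: comp_def)
  next
    case False
    then have dec: "s (r j) \<le> s (r i)" if "i \<le> j" for i j
      using r(2) that by (auto simp: monoseq_iff decseq_def)
    obtain N where N: "\<And>i. s (r N) \<le> s (r i)"
      using ex_has_least_nat[of "\<lambda>_. True" 0 "\<lambda>i. s (r i)"] by auto
    have "s (r (N + i)) = s (r N)" for i
      using N[of "N + i"] dec[of N "N + i"] by simp
    then have "incseq (s \<circ> (\<lambda>i. r (N + i)))"
      by (simp add: incseq_def)
    moreover have "strict_mono (\<lambda>i. r (N + i))"
      using r(1) by (simp add: strict_mono_def)
    ultimately show ?thesis
      by blast
  qed
qed

text \<open>
  Dickson's lemma, in the form in which it is used: vectors of natural numbers are well-quasi-ordered by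
  componentwise comparison.
\<close>

lemma common_incseq_subsequence:
  fixes f :: "'t \<Rightarrow> nat \<Rightarrow> nat"
  assumes "finite T"
  shows "\<exists>r :: nat \<Rightarrow> nat. strict_mono r \<and> (\<forall>t\<in>T. incseq (f t \<circ> r))"
  using assms
proof induction
  case empty
  show ?case
    using strict_mono_id by blast
next
  case (insert t T)
  then obtain r :: "nat \<Rightarrow> nat" where r: "strict_mono r" "\<forall>t\<in>T. incseq (f t \<circ> r)"
    by blast
  obtain r' :: "nat \<Rightarrow> nat" where r': "strict_mono r'" "incseq (f t \<circ> r \<circ> r')"
    using incseq_subsequence by blast
  have "incseq (f t' \<circ> (r \<circ> r'))" if "t' \<in> T" for t'
    using r(2) that strict_mono_leD[OF r'(1)] by (auto simp: incseq_def)
  moreover have "incseq (f t \<circ> (r \<circ> r'))"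
    using r'(2) by (simp only: comp_assoc)
  moreover have "strict_mono (r \<circ> r')"
    using r(1) r'(1) by (rule strict_mono_o)
  ultimately show ?case
    by blast
qed

text \<open>
  The well-quasi-order on pairs of an index and an order embedding. Dickson's lemma is applied to the
  index \<open>i\<close>, to \<open>N - i\<close>, to the first value and to the gaps of the embedding. Along the subsequence
  neither \<open>i\<close> nor \<open>N - i\<close> decreases, so the index is constant.
\<close>

lemma order_emb_ascending_subsequence:
  fixes deg :: "nat \<Rightarrow> nat"
  assumes "\<And>j. idx j < N" and q: "\<And>j. q j \<in> order_emb (deg (idx j)) (ns j)"
  shows "\<exists>r :: nat \<Rightarrow> nat. strict_mono r \<and> (\<forall>i j. i < j \<longrightarrow> idx (r i) = idx (r j) \<and>
    (\<exists>h\<in>order_emb (ns (r i)) (ns (r j)). h \<circ> q (r i) = q (r j)))"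
proof -
  \<comment> \<open>Any bound for all degrees will do: after position \<open>D\<close> all gaps equal \<open>1\<close>, so finitely many
     sequences suffice.\<close>
  define D where "D = (\<Sum>i<N. deg i)"
  define f where "f t j = (if t = 0 then idx j else if t = 1 then N - idx j
    else if t = 2 then q j 0 else q j (t - 2) - q j (t - 3))" for t j :: nat
  obtain r :: "nat \<Rightarrow> nat" where r: "strict_mono r" "\<forall>t\<in>{..<D + 3}. incseq (f t \<circ> r)"
    using common_incseq_subsequence[of "{..<D + 3}" f] by blast
  have f: "f t (r i) \<le> f t (r j)" if "i < j" "t < D + 3" for t i j
    using r(2) that by (auto simp: incseq_def)
  have "idx (r i) = idx (r j) \<and> (\<exists>h\<in>order_emb (ns (r i)) (ns (r j)). h \<circ> q (r i) = q (r j))"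
    if ij: "i < j" for i j
  proof
    show idx: "idx (r i) = idx (r j)"
      using f[OF ij, of 0] f[OF ij, of 1] assms(1)[of "r i"] assms(1)[of "r j"] by (simp add: f_def)
    let ?d = "deg (idx (r j))"
    have qi: "q (r i) \<in> order_emb ?d (ns (r i))" and qj: "q (r j) \<in> order_emb ?d (ns (r j))"
      using q[of "r i"] q[of "r j"] idx by simp_all
    have "?d \<le> D"
      unfolding D_def using assms(1) by (intro member_le_sum) auto
    show "\<exists>h\<in>order_emb (ns (r i)) (ns (r j)). h \<circ> q (r i) = q (r j)"
    proof (rule order_emb_factor[OF qi qj])
      show "q (r i) 0 \<le> q (r j) 0"
        using f[OF ij, of 2] by (simp add: f_def)
      show "q (r i) (Suc t) - q (r i) t \<le> q (r j) (Suc t) - q (r j) t" for t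
      proof (cases "t < D")
        case True
        then show ?thesis
          using f[OF ij, of "t + 3"] by (simp add: f_def numeral_eq_Suc)
      next
        case False
        then have "?d \<le> t"
          using \<open>?d \<le> D\<close> by simp
        then show ?thesis
          by (simp add: order_emb_beyond[OF qi] order_emb_beyond[OF qj])
      qed
    qed
  qed
  then show ?thesis
    using r(1) by blast
qed

section \<open>Ordered injections inside \<open>FI\<^sub>G\<close>\<close>

text \<open>
  A copy of \<open>{0, \<dots>, n - 1}\<close> among the objects, for a fixed injection \<open>\<iota>\<close> of the natural numbers into the
  points. Every finite set is isomorphic to exactly one of these.
\<close>

definition std_obj :: "(nat \<Rightarrow> 'x) \<Rightarrow> nat \<Rightarrow> 'x set" where
  "std_obj \<iota> n = \<iota> ` {..<n}"

definition std_mor ::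
    "('g, 'c) monoid_scheme \<Rightarrow> (nat \<Rightarrow> 'x) \<Rightarrow> nat \<Rightarrow> (nat \<Rightarrow> nat) \<Rightarrow> ('x, 'g) fig_mor" where
  "std_mor G \<iota> m h = (\<lambda>x\<in>std_obj \<iota> m. \<iota> (h (inv_into UNIV \<iota> x)), \<lambda>x\<in>std_obj \<iota> m. \<one>\<^bsub>G\<^esub>)"

lemma finite_std_obj [simp]: "finite (std_obj \<iota> n)"
  by (simp add: std_obj_def)

lemma fig_submodule_closed:
  "\<lbrakk>fig_submodule G k V A W; finite S; finite T; \<phi> \<in> fig_hom G S T; w \<in> W S\<rbrakk> \<Longrightarrow> A S T \<phi> w \<in> W T"
  unfolding fig_submodule_def by blast

lemma finite_fig_hom:
  assumes "finite (carrier G)" "finite S" "finite T"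
  shows "finite (fig_hom G S T)"
proof (rule finite_subset)
  show "fig_hom G S T \<subseteq> (S \<rightarrow>\<^sub>E T) \<times> (S \<rightarrow>\<^sub>E carrier G)"
    by (auto simp: fig_hom_def)
qed (use assms in \<open>simp add: finite_PiE\<close>)

context group
begin

lemma std_mor_in_hom:
  assumes \<iota>: "inj \<iota>" and h: "h \<in> order_emb m n"
  shows "std_mor G \<iota> m h \<in> fig_hom G (std_obj \<iota> m) (std_obj \<iota> n)"
proof -
  have "inj_on (\<lambda>x. \<iota> (h (inv_into UNIV \<iota> x))) (std_obj \<iota> m)"
    using \<iota> strict_mono_eq[OF order_emb_strict_mono[OF h]]
    by (intro inj_onI) (auto simp: std_obj_def inj_eq)
  then have "inj_on (\<lambda>x\<in>std_obj \<iota> m. \<iota> (h (inv_into UNIV \<iota> x))) (std_obj \<iota> m)"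
    by (simp add: inj_on_def)
  moreover have "\<iota> (h (inv_into UNIV \<iota> x)) \<in> std_obj \<iota> n" if "x \<in> std_obj \<iota> m" for x
    using that order_emb_less[OF h] \<iota> by (auto simp: std_obj_def)
  ultimately show ?thesis
    by (auto simp: std_mor_def fig_hom_def)
qed

lemma fig_comp_std_mor:
  assumes \<iota>: "inj \<iota>" and q: "q \<in> order_emb d m"
  shows "fig_comp G (std_obj \<iota> d) (std_mor G \<iota> m h) (std_mor G \<iota> d q) = std_mor G \<iota> d (h \<circ> q)"
  using \<iota> order_emb_less[OF q] by (auto simp: fig_comp_def std_mor_def std_obj_def intro!: restrict_ext)

text \<open>
  The order embedding \<open>h\<close> enumerates the image of \<open>\<phi>\<close> in increasing order. Since \<open>h\<close> is decorated
  by \<open>\<one>\<close>, the decoration of \<open>\<phi>\<close> passes unchanged to \<open>\<psi>\<close>.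
\<close>

lemma fig_hom_factor:
  assumes \<iota>: "inj \<iota>" and "finite S" and \<phi>: "\<phi> \<in> fig_hom G S (std_obj \<iota> n)"
  obtains h \<psi> where "h \<in> order_emb (card S) n" "\<psi> \<in> fig_hom G S (std_obj \<iota> (card S))"
    "\<phi> = fig_comp G S (std_mor G \<iota> (card S) h) \<psi>"
proof -
  obtain f g where fg: "\<phi> = (f, g)" "f \<in> S \<rightarrow>\<^sub>E std_obj \<iota> n" "inj_on f S" "g \<in> S \<rightarrow>\<^sub>E carrier G"
    using \<phi> by (auto simp: fig_hom_def)
  define Y where "Y = inv_into UNIV \<iota> ` f ` S"
  have "f ` S \<subseteq> range \<iota>"
    using fg(2) by (auto simp: std_obj_def)
  then have inj: "inj_on (inv_into UNIV \<iota>) (f ` S)"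
    by (rule inj_on_inv_into)
  have card: "card Y = card S"
    unfolding Y_def using inj fg(3) by (simp add: card_image)
  have "inv_into UNIV \<iota> (f x) < n" if "x \<in> S" for x
    using PiE_mem[OF fg(2) that] \<iota> by (auto simp: std_obj_def)
  then have "Y \<subseteq> {..<n}"
    by (auto simp: Y_def)
  then obtain h where h: "h \<in> order_emb (card S) n" "h ` {..<card S} = Y"
    using order_emb_onto card by metis
  have "\<exists>i<card S. \<iota> (h i) = f x" if "x \<in> S" for x
  proof -
    have "inv_into UNIV \<iota> (f x) \<in> h ` {..<card S}"
      using that h(2) by (simp add: Y_def)
    moreover have "\<iota> (inv_into UNIV \<iota> (f x)) = f x"
      using that \<open>f ` S \<subseteq> range \<iota>\<close> by (auto simp: f_inv_into_f)
    ultimately show ?thesis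
      by auto
  qed
  then obtain p where p: "\<And>x. x \<in> S \<Longrightarrow> p x < card S" "\<And>x. x \<in> S \<Longrightarrow> \<iota> (h (p x)) = f x"
    by metis
  define \<psi> where "\<psi> = (\<lambda>x\<in>S. \<iota> (p x), g)"
  show thesis
  proof (rule that[OF h(1)])
    have "inj_on (\<lambda>x. \<iota> (p x)) S"
    proof (rule inj_onI)
      fix x y assume "x \<in> S" "y \<in> S" "\<iota> (p x) = \<iota> (p y)"
      then have "f x = f y"
        using injD[OF \<iota>] p(2) by metis
      then show "x = y"
        using \<open>x \<in> S\<close> \<open>y \<in> S\<close> fg(3) by (simp add: inj_on_def)
    qed
    then have "inj_on (\<lambda>x\<in>S. \<iota> (p x)) S"
      by (simp add: inj_on_def)
    then show "\<psi> \<in> fig_hom G S (std_obj \<iota> (card S))"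
      using fg(4) p(1) by (auto simp: \<psi>_def fig_hom_def std_obj_def)
    show "\<phi> = fig_comp G S (std_mor G \<iota> (card S) h) \<psi>"
      unfolding fg(1) \<psi>_def fig_comp_def std_mor_def using p fg(2,4) \<iota>
      by (auto simp: std_obj_def fun_eq_iff PiE_iff extensional_def)
  qed
qed

lemma fig_iso_std_obj:
  assumes \<iota>: "inj \<iota>" and "finite S"
  obtains \<phi> \<psi> where "\<phi> \<in> fig_hom G S (std_obj \<iota> (card S))" "\<psi> \<in> fig_hom G (std_obj \<iota> (card S)) S"
    "fig_comp G S \<psi> \<phi> = fig_id G S"
proof -
  have "card (std_obj \<iota> (card S)) = card S"
    using \<iota> by (simp add: std_obj_def card_image inj_on_subset)
  then obtain f where f: "bij_betw f S (std_obj \<iota> (card S))"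
    using finite_same_card_bij[of S "std_obj \<iota> (card S)"] \<open>finite S\<close> by auto
  let ?T = "std_obj \<iota> (card S)"
  let ?\<phi> = "(\<lambda>x\<in>S. f x, \<lambda>x\<in>S. \<one>)" and ?\<psi> = "(\<lambda>x\<in>?T. inv_into S f x, \<lambda>x\<in>?T. \<one>)"
  have f': "bij_betw (inv_into S f) ?T S"
    using f by (rule bij_betw_inv_into)
  show thesis
  proof
    show "?\<phi> \<in> fig_hom G S ?T"
      using f by (auto simp: fig_hom_def bij_betw_def inj_on_restrict_eq)
    show "?\<psi> \<in> fig_hom G ?T S"
      using f' by (auto simp: fig_hom_def bij_betw_def inj_on_restrict_eq)
    show "fig_comp G S ?\<psi> ?\<phi> = fig_id G S"
      using f by (auto simp: fig_comp_def fig_id_def bij_betw_def intro!: restrict_ext)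
  qed
qed

end

section \<open>From \<open>FI\<^sub>G\<close>-modules to ordered injections\<close>

context fig_module
begin

lemma map_carrier:
  "\<lbrakk>finite S; finite T; \<phi> \<in> fig_hom G S T; v \<in> carrier (V S)\<rbrakk> \<Longrightarrow> A S T \<phi> v \<in> carrier (V T)"
  using mor[of S T \<phi>] by (auto simp: linear_maps_def)

text \<open>
  The spans of the images of the generators form a submodule of \<open>V\<close> that contains the generators.
\<close>

lemma carrier_subset_mspan:
  assumes E: "\<forall>(S, v)\<in>E. finite S \<and> v \<in> carrier (V S)"
    and gen: "\<not> (\<exists>W. fig_submodule G k V A W \<and> (\<forall>(S, v)\<in>E. v \<in> W S) \<and>
              (\<exists>S. finite S \<and> W S \<noteq> carrier (V S)))"
    and "finite T"
  shows "carrier (V T) \<subseteq> mspan k (V T) {A S T \<phi> v | S \<phi> v. (S, v) \<in> E \<and> \<phi> \<in> fig_hom G S T}"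
proof -
  define B where "B T = {A S T \<phi> v | S \<phi> v. (S, v) \<in> E \<and> \<phi> \<in> fig_hom G S T}" for T
  define Z where "Z T = mspan k (V T) (B T)" for T
  have B: "B T \<subseteq> carrier (V T)" if "finite T" for T
    using E that by (auto simp: B_def intro!: map_carrier)
  have "fig_submodule G k V A Z"
    unfolding fig_submodule_def
  proof (intro conjI allI impI ballI)
    fix S :: "'x set" assume "finite S"
    then show "submodule (Z S) k (V S)"
      unfolding Z_def by (intro module.mspan_submodule[OF obj] B)
  next
    fix S T :: "'x set" and \<phi> assume *: "finite S" "finite T" "\<phi> \<in> fig_hom G S T"
    have "A S T \<phi> ` B S \<subseteq> B T"
    proof
      fix w assume "w \<in> A S T \<phi> ` B S"
      then obtain S' \<psi> v where w: "(S', v) \<in> E" "\<psi> \<in> fig_hom G S' S" "w = A S T \<phi> (A S' S \<psi> v)"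
        by (auto simp: B_def)
      then have "w = A S' T (fig_comp G S' \<phi> \<psi>) v"
        using map_comp[of S' S T \<psi> \<phi> v] * E by auto
      moreover have "fig_comp G S' \<phi> \<psi> \<in> fig_hom G S' T"
        using w(2) *(3) by (rule G.fig_comp_in_hom)
      ultimately show "w \<in> B T"
        using w(1) unfolding B_def by blast
    qed
    then show "A S T \<phi> ` Z S \<subseteq> Z T"
      unfolding Z_def using * B mspan_superset[of "B T" k "V T"]
      by (intro linear_map_mspan obj mor) auto
  qed
  moreover have "v \<in> Z S" if "(S, v) \<in> E" for S v
  proof -
    have "v = A S S (fig_id G S) v"
      using map_id[of S v] E that by auto
    then have "v \<in> B S"
      using that G.fig_id_in_hom[of S] unfolding B_def by blast
    then show ?thesis
      unfolding Z_def by (rule subsetD[OF mspan_superset])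
  qed
  ultimately have "Z T = carrier (V T)"
    using gen \<open>finite T\<close> by blast
  then show ?thesis
    by (simp add: Z_def B_def)
qed

lemma submodule_eqI_std_obj:
  assumes \<iota>: "inj \<iota>" and W: "fig_submodule G k V A W" and W': "fig_submodule G k V A W'"
    and eq: "\<And>n. W (std_obj \<iota> n) = W' (std_obj \<iota> n)" and S: "finite S"
  shows "W S = W' S"
proof -
  obtain \<phi> \<psi> where iso: "\<phi> \<in> fig_hom G S (std_obj \<iota> (card S))" "\<psi> \<in> fig_hom G (std_obj \<iota> (card S)) S"
    "fig_comp G S \<psi> \<phi> = fig_id G S"
    using G.fig_iso_std_obj[OF \<iota> S] by blast
  have "U S \<subseteq> U' S"
    if U: "fig_submodule G k V A U" and U': "fig_submodule G k V A U'"
      and UU': "U (std_obj \<iota> (card S)) = U' (std_obj \<iota> (card S))" for U U'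
  proof
    fix w assume w: "w \<in> U S"
    have "w \<in> carrier (V S)"
      using module.submoduleE(1)[OF obj[OF S], of "U S"] U S w by (auto simp: fig_submodule_def)
    then have "w = A (std_obj \<iota> (card S)) S \<psi> (A S (std_obj \<iota> (card S)) \<phi> w)"
      using map_comp[OF S _ S iso(1,2), of w] map_id[OF S, of w] iso(3) by simp
    moreover have "A S (std_obj \<iota> (card S)) \<phi> w \<in> U' (std_obj \<iota> (card S))"
      using fig_submodule_closed[OF U S finite_std_obj iso(1) w] UU' by simp
    ultimately show "w \<in> U' S"
      using fig_submodule_closed[OF U' finite_std_obj S iso(2)] by metis
  qed
  from this[OF W W'] this[OF W' W] eq show ?thesis
    by blast
qed

end

text \<open>
  The order on monomials \<open>(i, q)\<close>: first by generator, then lexicographically by the points of \<open>q\<close>.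
  Strictly increasing maps preserve it because they preserve the first difference.
\<close>

definition term_less :: "nat \<times> (nat \<Rightarrow> nat) \<Rightarrow> nat \<times> (nat \<Rightarrow> nat) \<Rightarrow> bool" where
  "term_less = (\<lambda>(i, q) (j, q'). i < j \<or> i = j \<and> less_fun q q')"

lemma transp_term_less: "transp term_less"
  by (auto simp: transp_def term_less_def intro: less_fun_trans)

lemma asymp_term_less: "asymp term_less"
  by (auto simp: asymp_on_def term_less_def dest: less_fun_asym)

context fig_module
begin

lemma monomial_system_std:
  fixes deg :: "nat \<Rightarrow> nat" and gen :: "nat \<Rightarrow> 'v"
  assumes k: "noetherian_ring k" and \<iota>: "inj \<iota>"
    and gen: "\<And>i. i < N \<Longrightarrow> gen i \<in> carrier (V (std_obj \<iota> (deg i)))"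
    and span: "\<And>n. carrier (V (std_obj \<iota> n)) \<subseteq> mspan k (V (std_obj \<iota> n))
      {A (std_obj \<iota> (deg i)) (std_obj \<iota> n) (std_mor G \<iota> (deg i) q) (gen i) | i q.
        i < N \<and> q \<in> order_emb (deg i) n}"
  shows "monomial_system k (\<lambda>n. V (std_obj \<iota> n))
    (\<lambda>n. SIGMA i:{..<N}. order_emb (deg i) n)
    (\<lambda>n (i, q). A (std_obj \<iota> (deg i)) (std_obj \<iota> n) (std_mor G \<iota> (deg i) q) (gen i))
    term_less order_emb
    (\<lambda>m n h. A (std_obj \<iota> m) (std_obj \<iota> n) (std_mor G \<iota> m h))
    (\<lambda>h (i, q). (i, h \<circ> q))"
    (is "monomial_system k ?M ?X ?e _ _ ?act ?push")
proof (rule monomial_system.intro)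
  show "module k (?M n)" for n
    by (simp add: obj)
  show "finite (?X n)" for n
    by (simp add: finite_order_emb)
  show "?e n x \<in> carrier (?M n)" if "x \<in> ?X n" for n x
    using that gen by (auto intro!: map_carrier G.std_mor_in_hom[OF \<iota>])
  have "?e n ` ?X n = {A (std_obj \<iota> (deg i)) (std_obj \<iota> n) (std_mor G \<iota> (deg i) q) (gen i) | i q.
      i < N \<and> q \<in> order_emb (deg i) n}" for n
    by (auto simp: image_iff Bex_def)
  with span show "carrier (?M n) \<subseteq> mspan k (?M n) (?e n ` ?X n)" for n
    by simp
  show "term_less x y \<or> term_less y x" if "x \<in> ?X n" "y \<in> ?X n" "x \<noteq> y" for n x y
    using that less_fun_order_emb_total[of "snd x" "deg (fst x)" n "snd y"]
    by (auto simp: term_less_def)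
next
  fix m n h assume h: "h \<in> order_emb m n"
  show "?act m n h \<in> linear_maps k (?M m) (?M n)"
    by (intro mor G.std_mor_in_hom[OF \<iota> h]) simp_all
  fix x assume x: "x \<in> ?X m"
  then show "?push h x \<in> ?X n"
    using h by (auto intro: order_emb_comp)
  obtain i q where iq: "x = (i, q)" "i < N" "q \<in> order_emb (deg i) m"
    using x by auto
  have "?act m n h (?e m x) = A (std_obj \<iota> (deg i)) (std_obj \<iota> n)
      (fig_comp G (std_obj \<iota> (deg i)) (std_mor G \<iota> m h) (std_mor G \<iota> (deg i) q)) (gen i)"
    unfolding iq(1) using gen[OF iq(2)] G.std_mor_in_hom[OF \<iota>] iq(3) h
    by (simp add: map_comp[of _ "std_obj \<iota> m" "std_obj \<iota> n"])
  then show "?act m n h (?e m x) = ?e n (?push h x)"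
    by (simp add: iq(1) G.fig_comp_std_mor[OF \<iota> iq(3)])
  fix y assume "term_less x y"
  then show "term_less (?push h x) (?push h y)"
    using less_fun_comp[OF order_emb_strict_mono[OF h]] by (auto simp: term_less_def)
next
  fix xs :: "nat \<Rightarrow> nat \<times> (nat \<Rightarrow> nat)" and ns :: "nat \<Rightarrow> nat"
  assume xs: "\<And>j. xs j \<in> ?X (ns j)"
  have "fst (xs j) < N" "snd (xs j) \<in> order_emb (deg (fst (xs j))) (ns j)" for j
    using xs[of j] by auto
  then obtain r :: "nat \<Rightarrow> nat" where r: "strict_mono r"
    "\<And>i j. i < j \<Longrightarrow> fst (xs (r i)) = fst (xs (r j)) \<and>
      (\<exists>h\<in>order_emb (ns (r i)) (ns (r j)). h \<circ> snd (xs (r i)) = snd (xs (r j)))"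
    using order_emb_ascending_subsequence[of "\<lambda>j. fst (xs j)" N "\<lambda>j. snd (xs j)" deg ns] by blast
  have "\<exists>h\<in>order_emb (ns (r i)) (ns (r j)). ?push h (xs (r i)) = xs (r j)" if "i < j" for i j
    using r(2)[OF that] by (auto simp: case_prod_beta prod_eq_iff)
  with r(1) show "\<exists>r :: nat \<Rightarrow> nat. strict_mono r \<and> (\<forall>i j. i < j \<longrightarrow>
      (\<exists>h\<in>order_emb (ns (r i)) (ns (r j)). ?push h (xs (r i)) = xs (r j)))"
    by blast
qed (rule k transp_term_less asymp_term_less)+

text \<open>
  This is where the finiteness of \<open>G\<close> enters: the images of the given generators under all morphisms
  to the standard object of the same cardinality are finite in number, and they generate over order
  embeddings alone. They are numbered because the order on monomials needs an order on generators.
\<close>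

lemma order_emb_generators:
  assumes "finite (carrier G)" and \<iota>: "inj \<iota>"
    and fg: "fig_finitely_generated G k V A"
  obtains N :: nat and deg gen where
    "\<And>i. i < N \<Longrightarrow> gen i \<in> carrier (V (std_obj \<iota> (deg i)))"
    "\<And>n. carrier (V (std_obj \<iota> n)) \<subseteq> mspan k (V (std_obj \<iota> n))
      {A (std_obj \<iota> (deg i)) (std_obj \<iota> n) (std_mor G \<iota> (deg i) q) (gen i) | i q.
        i < N \<and> q \<in> order_emb (deg i) n}"
proof -
  obtain E where E: "finite E" "\<forall>(S, v)\<in>E. finite S \<and> v \<in> carrier (V S)"
    and gen: "\<not> (\<exists>W. fig_submodule G k V A W \<and> (\<forall>(S, v)\<in>E. v \<in> W S) \<and>
              (\<exists>S. finite S \<and> W S \<noteq> carrier (V S)))"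
    using fg unfolding fig_finitely_generated_def by blast
  define Q where "Q = (\<Union>(S, v)\<in>E. (\<lambda>\<psi>. (card S, A S (std_obj \<iota> (card S)) \<psi> v)) `
    fig_hom G S (std_obj \<iota> (card S)))"
  have "finite Q"
    unfolding Q_def using E by (intro finite_UN_I) (auto intro!: finite_fig_hom assms)
  then obtain gs where gs: "set gs = Q"
    using finite_list by blast
  show thesis
  proof (rule that[of "length gs" "\<lambda>i. snd (gs ! i)" "\<lambda>i. fst (gs ! i)"])
    fix i assume "i < length gs"
    then have "gs ! i \<in> Q"
      using gs by auto
    then show "snd (gs ! i) \<in> carrier (V (std_obj \<iota> (fst (gs ! i))))"
      using E(2) by (auto simp: Q_def intro!: map_carrier)
  next
    fix n
    let ?B = "{A (std_obj \<iota> (fst (gs ! i))) (std_obj \<iota> n) (std_mor G \<iota> (fst (gs ! i)) q) (snd (gs ! i)) | i q.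
        i < length gs \<and> q \<in> order_emb (fst (gs ! i)) n}"
    have "{A S (std_obj \<iota> n) \<phi> v | S \<phi> v. (S, v) \<in> E \<and> \<phi> \<in> fig_hom G S (std_obj \<iota> n)} \<subseteq> ?B"
    proof clarify
      fix S \<phi> v assume Sv: "(S, v) \<in> E" and \<phi>: "\<phi> \<in> fig_hom G S (std_obj \<iota> n)"
      have S: "finite S" "v \<in> carrier (V S)"
        using E(2) Sv by auto
      obtain h \<psi> where h: "h \<in> order_emb (card S) n" and \<psi>: "\<psi> \<in> fig_hom G S (std_obj \<iota> (card S))"
        and eq: "\<phi> = fig_comp G S (std_mor G \<iota> (card S) h) \<psi>"
        using G.fig_hom_factor[OF \<iota> S(1) \<phi>] by blast
      have "(card S, A S (std_obj \<iota> (card S)) \<psi> v) \<in> set gs"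
        using Sv \<psi> unfolding gs Q_def by blast
      then obtain i where i: "i < length gs" "gs ! i = (card S, A S (std_obj \<iota> (card S)) \<psi> v)"
        by (auto simp: in_set_conv_nth)
      have "A S (std_obj \<iota> n) \<phi> v =
          A (std_obj \<iota> (card S)) (std_obj \<iota> n) (std_mor G \<iota> (card S) h) (A S (std_obj \<iota> (card S)) \<psi> v)"
        unfolding eq using S \<psi> G.std_mor_in_hom[OF \<iota> h]
        by (simp add: map_comp[of S "std_obj \<iota> (card S)" "std_obj \<iota> n"])
      with i h show "\<exists>i q. A S (std_obj \<iota> n) \<phi> v = A (std_obj \<iota> (fst (gs ! i))) (std_obj \<iota> n)
          (std_mor G \<iota> (fst (gs ! i)) q) (snd (gs ! i)) \<and> i < length gs \<and> q \<in> order_emb (fst (gs ! i)) n"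
        by (intro exI[of _ i] exI[of _ h]) simp
    qed
    then show "carrier (V (std_obj \<iota> n)) \<subseteq> mspan k (V (std_obj \<iota> n)) ?B"
      using carrier_subset_mspan[OF E(2) gen finite_std_obj] mspan_mono by (metis (no_types, lifting) order_trans)
  qed
qed

lemma fig_submodule_trans:
  assumes W: "fig_submodule G k V A W" and U: "fig_submodule G k (fig_restrict V W) A U"
  shows "fig_submodule G k V A U" and "\<And>S. finite S \<Longrightarrow> U S \<subseteq> W S"
proof -
  have "U S \<subseteq> W S \<and> submodule (U S) k (V S)" if S: "finite S" for S
  proof -
    interpret M: module k "V S"
      by (rule obj[OF S])
    have W: "submodule (W S) k (V S)" and U: "submodule (U S) k (V S\<lparr>carrier := W S\<rparr>)"
      using W U S by (simp_all add: fig_submodule_def fig_restrict_def)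
    note R = submodule.submodule_is_module[OF W obj[OF S]]
    have UW: "U S \<subseteq> W S"
      using module.submoduleE(1)[OF R U] by simp
    moreover have "submodule (U S) k (V S)"
    proof (rule M.submoduleI_no_inv)
      show "U S \<subseteq> carrier (V S)"
        using UW M.submoduleE(1)[OF W] by blast
      show "\<zero>\<^bsub>V S\<^esub> \<in> U S"
        using module.submodule_zero[OF R U] by simp
    qed (use module.submoduleE(4,5)[OF R U] in simp_all)
    ultimately show ?thesis
      by blast
  qed
  with U show "fig_submodule G k V A U" and "\<And>S. finite S \<Longrightarrow> U S \<subseteq> W S"
    by (auto simp: fig_submodule_def)
qed

end

section \<open>The category \<open>FI\<^sub>G\<close> is locally Noetherian\<close>

theorem theorem2p3:
  fixes G :: "('g, 'c) monoid_scheme"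
    and k :: "('k, 'd) ring_scheme"
    and V :: "'x::infinite set \<Rightarrow> ('k, 'v) module"
    and A :: "'x set \<Rightarrow> 'x set \<Rightarrow> ('x, 'g) fig_mor \<Rightarrow> 'v \<Rightarrow> 'v"
    and W :: "'x set \<Rightarrow> 'v set"
  assumes "group G" and "finite (carrier G)"
    and "cring k" and "noetherian_ring k"
    and "fig_module G k V A"
    and "fig_finitely_generated G k V A"
    and "fig_submodule G k V A W"
  shows "fig_finitely_generated G k (fig_restrict V W) A"
proof -
  interpret fig_module G k V A by fact
  obtain \<iota> :: "nat \<Rightarrow> 'x" where \<iota>: "inj \<iota>"
    using infinite_countable_subset[OF infinite_UNIV] by blast
  obtain N :: nat and deg gen where
    "\<And>i. i < N \<Longrightarrow> gen i \<in> carrier (V (std_obj \<iota> (deg i)))"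
    "\<And>n. carrier (V (std_obj \<iota> n)) \<subseteq> mspan k (V (std_obj \<iota> n))
      {A (std_obj \<iota> (deg i)) (std_obj \<iota> n) (std_mor G \<iota> (deg i) q) (gen i) | i q.
        i < N \<and> q \<in> order_emb (deg i) n}"
    by (rule order_emb_generators[OF assms(2) \<iota> assms(6)]) (rule that)
  then interpret M: monomial_system k "\<lambda>n. V (std_obj \<iota> n)"
    "\<lambda>n. SIGMA i:{..<N}. order_emb (deg i) n"
    "\<lambda>n (i, q). A (std_obj \<iota> (deg i)) (std_obj \<iota> n) (std_mor G \<iota> (deg i) q) (gen i)"
    term_less order_emb
    "\<lambda>m n h. A (std_obj \<iota> m) (std_obj \<iota> n) (std_mor G \<iota> m h)"
    "\<lambda>h (i, q). (i, h \<circ> q)"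
    by (rule monomial_system_std[OF assms(4) \<iota>])
  have stable: "M.stable (\<lambda>n. U (std_obj \<iota> n))" if "fig_submodule G k V A U" for U
    using that G.std_mor_in_hom[OF \<iota>] unfolding M.stable_def fig_submodule_def by simp
  obtain E where E: "finite E" "\<forall>(n, w)\<in>E. w \<in> W (std_obj \<iota> n)"
    and gen: "\<forall>U. M.stable U \<longrightarrow> (\<forall>n. U n \<subseteq> W (std_obj \<iota> n)) \<longrightarrow> (\<forall>(n, w)\<in>E. w \<in> U n) \<longrightarrow>
      U = (\<lambda>n. W (std_obj \<iota> n))"
    using M.stable_finitely_generated[OF stable[OF assms(7)]] by (elim exE conjE)
  show ?thesis
    unfolding fig_finitely_generated_def
  proof (intro exI[of _ "(\<lambda>(n, w). (std_obj \<iota> n, w)) ` E"] conjI notI)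
    show "finite ((\<lambda>(n, w). (std_obj \<iota> n, w)) ` E)"
      using E(1) by simp
    show "\<forall>(S, v)\<in>(\<lambda>(n, w). (std_obj \<iota> n, w)) ` E. finite S \<and> v \<in> carrier (fig_restrict V W S)"
      using E(2) by (auto simp: fig_restrict_def)
  next
    assume "\<exists>U. fig_submodule G k (fig_restrict V W) A U \<and>
      (\<forall>(S, v)\<in>(\<lambda>(n, w). (std_obj \<iota> n, w)) ` E. v \<in> U S) \<and>
      (\<exists>S. finite S \<and> U S \<noteq> carrier (fig_restrict V W S))"
    then obtain U S where U: "fig_submodule G k (fig_restrict V W) A U"
      "\<And>n w. (n, w) \<in> E \<Longrightarrow> w \<in> U (std_obj \<iota> n)" and S: "finite S" "U S \<noteq> W S"
      by (fastforce simp: fig_restrict_def)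
    have UV: "fig_submodule G k V A U" and UW: "\<And>T. finite T \<Longrightarrow> U T \<subseteq> W T"
      using fig_submodule_trans[OF assms(7) U(1)] by auto
    have "(\<lambda>n. U (std_obj \<iota> n)) = (\<lambda>n. W (std_obj \<iota> n))"
      using UW[OF finite_std_obj] U(2)
      by (intro gen[THEN spec, THEN mp, THEN mp, THEN mp] stable[OF UV]) auto
    then have "U (std_obj \<iota> n) = W (std_obj \<iota> n)" for n
      by (rule fun_cong)
    then show False
      using submodule_eqI_std_obj[OF \<iota> UV assms(7) _ S(1)] S(2) by blast
  qed
qed

end
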